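(* Let the kernel $k$ of the integral equation $f(y)+\int_{\mathcal D}k(x,y)f(x)\,d\mu(x)=g(y)$, $y\in\mathcal D$, satisfy $$\|k\|_\infty=\sup_{y\in\mathcal D}\|k(\cdot,y)\|_\infty<\beta_0^{-1},$$ where $\beta_0=\langle p_0,p_0\rangle_\mu=\int_{\mathcal D}d\mu$. Then, for sufficiently large $m$, the iteration process $$\begin{aligned}(I_m+\Phi_{11})\,\mathbf b^{(k+1)}&=\mathbf g^{(G)}-\Phi_{12}\,\mathbf c^{(k)},\\ \mathbf c^{(k+1)}&=\mathbf g^*-\Phi_{21}\,\mathbf b^{(k+1)}-\Phi_{22}\,\mathbf c^{(k)},\end{aligned}\qquad k=0,1,2,\dots,$$ (with any initial vector $\mathbf c^{(0)}\in\mathbb R^{m+1}$) converges to the vectors $$\mathbf b=[\widehat f^{[1]}_{2m+1}(x_1^{(G)}),\dots,\widehat f^{[1]}_{2m+1}(x_m^{(G)})]^T,\qquad \mathbf c=[\widehat f^{[1]}_{2m+1}(x_1^* ),\dots,\widehat f^{[1]}_{2m+1}(x_{m+1}^* )]^T.$$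
   Context: $\mathcal D\subseteq\mathbb R$ is a bounded or infinite interval and $d\mu$ is a nonnegative measure supported on $\mathcal D$ with infinitely many points of support and finite moments; the weight of the function space is $u\equiv1$. Put $\langle f,g\rangle_\mu=\int_{\mathcal D}f g\,d\mu$. The monic orthogonal polynomials $p_k$ of $d\mu$ satisfy $p_{-1}=0$, $p_0=1$, $p_{k+1}(x)=(x-\alpha_k)p_k(x)-\beta_kp_{k-1}(x)$, with $\alpha_k=\langle xp_k,p_k\rangle_\mu/\langle p_k,p_k\rangle_\mu$ ($k\ge0$), $\beta_k=\langle p_k,p_k\rangle_\mu/\langle p_{k-1},p_{k-1}\rangle_\mu$ ($k\ge1$), $\beta_0=\langle p_0,p_0\rangle_\mu$. $J_m$ is the symmetric tridiagonal $m\times m$ matrix with diagonal $\alpha_0,\dots,\alpha_{m-1}$ and sub-/superdiagonal $\sqrt{\beta_1},\dots,\sqrt{\beta_{m-1}}$. $G_m(f)=\sum_{k=1}^m\lambda_k^{(G)}f(x_k^{(G)})$ is the $m$-point Gauss rule for $d\mu$. The rule $G^*_{m+1}(f)=\sum_{k=1}^{m+1}\lambda_k^*f(x_k^* )$ has as nodes the eigenvalues of $$J^*_{m+1}=\begin{bmatrix}J_m&\sqrt{\beta_m+\beta_{m+1}}\,\mathbf e_m\\ \sqrt{\beta_m+\beta_{m+1}}\,\mathbf e_m^T&\alpha_m\end{bmatrix}$$ ($\mathbf e_m$ the last axis vector of $\mathbb R^m$), and weights $\lambda_k^*=\beta_0 (v^*_{k,1})^2$ with $v^*_{k,1}$ the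 first component of a normalized real eigenvector for $x_k^*$. All nodes are understood to lie in $\mathcal D$. Put $\theta_m^{(1)}=\frac{\beta_{m+1}}{\beta_m+\beta_{m+1}}$, $\theta_m^{(2)}=\frac{\beta_m}{\beta_m+\beta_{m+1}}$, and $$(\Phi_{11})_{ij}=\theta_m^{(1)}\lambda_j^{(G)}k(x_j^{(G)},x_i^{(G)}),\quad(\Phi_{12})_{ij}=\theta_m^{(2)}\lambda_j^*k(x_j^*,x_i^{(G)}),$$ $$(\Phi_{21})_{ij}=\theta_m^{(1)}\lambda_j^{(G)}k(x_j^{(G)},x_i^* ),\quad(\Phi_{22})_{ij}=\theta_m^{(2)}\lambda_j^*k(x_j^*,x_i^* ),$$ of sizes $m\times m$, $m\times(m+1)$, $(m+1)\times m$, $(m+1)\times(m+1)$ respectively; $\mathbf g^{(G)}=[g(x_i^{(G)})]_{i=1}^m$, $\mathbf g^*=[g(x_i^* )]_{i=1}^{m+1}$. $I_n$ is the $n\times n$ identity matrix. The weighted averaged Nystr\"om interpolant $\widehat f^{[1]}_{2m+1}$ is the solution of $$\widehat f^{[1]}_{2m+1}(y)+\theta_m^{(1)}\sum_{j=1}^m\lambda_j^{(G)}k(x_j^{(G)},y)\widehat f^{[1]}_{2m+1}(x_j^{(G)})+\theta_m^{(2)}\sum_{j=1}^{m+1}\lambda_j^*k(x_j^*,y)\widehat f^{[1]}_{2m+1}(x_j^* )=g(y),\quad y\in\mathcal D.$$ *)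

theory Defs
  imports
    "HOL-Analysis.Analysis"
    "HOL-Computational_Algebra.Polynomial"
    "Jordan_Normal_Form.Char_Poly"
begin

unbundle no vec_syntax \<comment> \<open>\<open>$\<close> denotes indexing of \<open>Matrix.vec\<close> only\<close>

section \<open>Orthogonal polynomials\<close>

definition measure_support :: "real measure \<Rightarrow> real set" where
  "measure_support \<mu> = {x. \<forall>U. open U \<and> x \<in> U \<longrightarrow> emeasure \<mu> U > 0}"

definition inner_mu :: "real measure \<Rightarrow> real set \<Rightarrow> (real \<Rightarrow> real) \<Rightarrow> (real \<Rightarrow> real) \<Rightarrow> real" where
  "inner_mu \<mu> D f g = (LINT x:D|\<mu>. f x * g x)"

definition monic_op :: "real measure \<Rightarrow> real set \<Rightarrow> nat \<Rightarrow> real poly" where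
  "monic_op \<mu> D n = (THE p. degree p = n \<and> lead_coeff p = 1 \<and>
     (\<forall>q. degree q < n \<longrightarrow> inner_mu \<mu> D (poly p) (poly q) = 0))"

definition sqnorm_op :: "real measure \<Rightarrow> real set \<Rightarrow> nat \<Rightarrow> real" where
  "sqnorm_op \<mu> D n = inner_mu \<mu> D (poly (monic_op \<mu> D n)) (poly (monic_op \<mu> D n))"

definition alpha :: "real measure \<Rightarrow> real set \<Rightarrow> nat \<Rightarrow> real" where
  "alpha \<mu> D n =
     inner_mu \<mu> D (\<lambda>x. x * poly (monic_op \<mu> D n) x) (poly (monic_op \<mu> D n)) / sqnorm_op \<mu> D n"

definition beta :: "real measure \<Rightarrow> real set \<Rightarrow> nat \<Rightarrow> real" where
  "beta \<mu> D n = (if n = 0 then sqnorm_op \<mu> D 0 else sqnorm_op \<mu> D n / sqnorm_op \<mu> D (n - 1))"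

section \<open>Jacobi matrices and quadrature rules\<close>

definition jacobi_mat :: "real measure \<Rightarrow> real set \<Rightarrow> nat \<Rightarrow> real mat" where
  "jacobi_mat \<mu> D m = mat m m (\<lambda>(i, j).
     if i = j then alpha \<mu> D i
     else if j = Suc i then sqrt (beta \<mu> D j)
     else if i = Suc j then sqrt (beta \<mu> D i)
     else 0)"

text \<open>The bordered matrix \<open>J\<^sup>*\<close> of size \<open>m + 1\<close>. Vector indices start at 0, so the
  last axis vector is \<open>unit_vec m (m - 1)\<close>; the definition is meant for \<open>m \<ge> 1\<close>.\<close>

definition jacobi_star_mat :: "real measure \<Rightarrow> real set \<Rightarrow> nat \<Rightarrow> real mat" where
  "jacobi_star_mat \<mu> D m =
     (let e = sqrt (beta \<mu> D m + beta \<mu> D (Suc m)) \<cdot>\<^sub>v unit_vec m (m - 1)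
      in four_block_mat (jacobi_mat \<mu> D m) (mat_of_cols m [e])
                        (mat_of_rows m [e]) (mat 1 1 (\<lambda>_. alpha \<mu> D m)))"

text \<open>Rules are pairs of functions \<open>x\<close> (nodes) and \<open>w\<close> (weights) on the indices below the
  number of nodes; the order of the nodes is left arbitrary. The \<open>m\<close>-point Gauss rule is the
  \<open>m\<close>-point rule that is exact on all polynomials of degree at most \<open>2 * m - 1\<close>.\<close>

definition is_gauss_rule ::
  "real measure \<Rightarrow> real set \<Rightarrow> nat \<Rightarrow> (nat \<Rightarrow> real) \<Rightarrow> (nat \<Rightarrow> real) \<Rightarrow> bool" where
  "is_gauss_rule \<mu> D m x w \<longleftrightarrow> inj_on x {..<m} \<and>
     (\<forall>p. degree p < 2 * m \<longrightarrow> (\<Sum>j<m. w j * poly p (x j)) = (LINT t:D|\<mu>. poly p t))"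

text \<open>The off-diagonal entries of \<open>J\<^sup>*\<close> are positive, so its eigenvalues are simple: there
  are exactly \<open>m + 1\<close> of them and the weights below do not depend on the choice of \<open>v\<close>.\<close>

definition is_star_rule ::
  "real measure \<Rightarrow> real set \<Rightarrow> nat \<Rightarrow> (nat \<Rightarrow> real) \<Rightarrow> (nat \<Rightarrow> real) \<Rightarrow> bool" where
  "is_star_rule \<mu> D m x w \<longleftrightarrow>
     bij_betw x {..<Suc m} {t. eigenvalue (jacobi_star_mat \<mu> D m) t} \<and>
     (\<forall>j<Suc m. \<exists>v. eigenvector (jacobi_star_mat \<mu> D m) v (x j) \<and> v \<bullet> v = 1 \<and>
        w j = beta \<mu> D 0 * (v $ 0)\<^sup>2)"

section \<open>The averaged Nystroem method\<close>

definition theta1 :: "real measure \<Rightarrow> real set \<Rightarrow> nat \<Rightarrow> real" where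
  "theta1 \<mu> D m = beta \<mu> D (Suc m) / (beta \<mu> D m + beta \<mu> D (Suc m))"

definition theta2 :: "real measure \<Rightarrow> real set \<Rightarrow> nat \<Rightarrow> real" where
  "theta2 \<mu> D m = beta \<mu> D m / (beta \<mu> D m + beta \<mu> D (Suc m))"

text \<open>Extended-real valued, so that an unbounded kernel has norm \<open>\<infinity>\<close>.\<close>

definition kernel_norm :: "real set \<Rightarrow> (real \<Rightarrow> real \<Rightarrow> real) \<Rightarrow> ereal" where
  "kernel_norm D K = (SUP y\<in>D. SUP x\<in>D. ereal \<bar>K x y\<bar>)"

definition is_averaged_interpolant ::
  "real measure \<Rightarrow> real set \<Rightarrow> nat \<Rightarrow> (nat \<Rightarrow> real) \<Rightarrow> (nat \<Rightarrow> real) \<Rightarrow> (nat \<Rightarrow> real) \<Rightarrow> (nat \<Rightarrow> real) \<Rightarrow>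
   (real \<Rightarrow> real \<Rightarrow> real) \<Rightarrow> (real \<Rightarrow> real) \<Rightarrow> (real \<Rightarrow> real) \<Rightarrow> bool" where
  "is_averaged_interpolant \<mu> D m xG wG xS wS K g f \<longleftrightarrow>
     (\<forall>y\<in>D. f y + theta1 \<mu> D m * (\<Sum>j<m. wG j * K (xG j) y * f (xG j))
               + theta2 \<mu> D m * (\<Sum>j<Suc m. wS j * K (xS j) y * f (xS j)) = g y)"

text \<open>Entry \<open>(i, j)\<close> is \<open>\<theta> w\<^sub>j K(x\<^sub>j, z\<^sub>i)\<close>: \<open>x\<close> and \<open>w\<close> form the rule of the
  columns, \<open>z\<close> are the collocation points of the rows.\<close>

definition nystrom_block ::
  "real \<Rightarrow> nat \<Rightarrow> (nat \<Rightarrow> real) \<Rightarrow> nat \<Rightarrow> (nat \<Rightarrow> real) \<Rightarrow> (nat \<Rightarrow> real) \<Rightarrow>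
   (real \<Rightarrow> real \<Rightarrow> real) \<Rightarrow> real mat" where
  "nystrom_block \<theta> r z n x w K = mat r n (\<lambda>(i, j). \<theta> * w j * K (x j) (z i))"

text \<open>The iterate \<open>b 0\<close> is not used and left unconstrained.\<close>

definition is_block_iteration ::
  "nat \<Rightarrow> real mat \<Rightarrow> real mat \<Rightarrow> real mat \<Rightarrow> real mat \<Rightarrow> real vec \<Rightarrow> real vec \<Rightarrow> real vec \<Rightarrow>
   (nat \<Rightarrow> real vec) \<Rightarrow> (nat \<Rightarrow> real vec) \<Rightarrow> bool" where
  "is_block_iteration m \<Phi>11 \<Phi>12 \<Phi>21 \<Phi>22 gG gS c0 b c \<longleftrightarrow>
     c 0 = c0 \<and>
     (\<forall>n. b (Suc n) \<in> carrier_vec m \<and>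
          (1\<^sub>m m + \<Phi>11) *\<^sub>v b (Suc n) = gG - \<Phi>12 *\<^sub>v c n \<and>
          c (Suc n) = gS - \<Phi>21 *\<^sub>v b (Suc n) - \<Phi>22 *\<^sub>v c n)"

definition vec_tendsto :: "nat \<Rightarrow> (nat \<Rightarrow> real vec) \<Rightarrow> real vec \<Rightarrow> bool" where
  "vec_tendsto d X L \<longleftrightarrow> (\<forall>i<d. (\<lambda>n. X n $ i) \<longlonglongrightarrow> L $ i)"

end

theory Submission
  imports Defs
begin

text \<open>Everything rests on one contraction constant. Let \<open>\<kappa> = \<parallel>k\<parallel>\<^sub>\<infinity>\<close> and
  \<open>q = \<kappa> \<beta>\<^sub>0\<close>, so \<open>q < 1\<close>. Both rules have nonnegative weights of total mass \<open>\<beta>\<^sub>0\<close>: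
  for the Gauss rule this follows from exactness on squared nodal polynomials and on constants,
  for the bordered Jacobi matrix from the fact that the unit eigenvectors of a symmetric matrix
  with simple spectrum form an orthogonal matrix, whose first row has norm one. Hence, with
  \<open>\<theta>\<^sub>1\<close> and \<open>\<theta>\<^sub>2\<close> nonnegative of sum at most one, every discretized integral operator in
  sight has maximum-norm at most \<open>q\<close>, respectively \<open>\<theta>\<^sub>1 q\<close> and \<open>\<theta>\<^sub>2 q\<close> for its two parts.

  Solvability is then the maximum principle for \<open>I + A\<close> with \<open>\<parallel>A\<parallel>\<^sub>\<infinity> < 1\<close>, applied once to
  \<open>\<Phi>\<^sub>1\<^sub>1\<close> and once to the union of the two rules, whose Nystroem interpolant is the averaged
  interpolant. If \<open>r\<close> bounds the error of \<open>c(n)\<close>, the first half step gives an error of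
  \<open>b(n + 1)\<close> of at most \<open>\<theta>\<^sub>2 q r / (1 - \<theta>\<^sub>1 q)\<close>, which is at most \<open>q r\<close>, and the second
  half step then gives at most \<open>q r\<close> for \<open>c(n + 1)\<close>. The convergence is therefore geometric with
  ratio at most \<open>q\<close>, and it holds for every \<open>m \<ge> 1\<close>.\<close>

section \<open>Linear systems with a contractive part\<close>

text \<open>The form in which contractivity is used throughout: evaluate the hypothesis at the
  largest entry of \<open>u\<close> and solve \<open>r \<le> a r + d\<close> for \<open>r\<close>.\<close>

lemma self_improving_sup_bound:
  fixes u :: "'i \<Rightarrow> real"
  assumes fin: "finite I" and a: "a < 1"
    and improve: "\<And>r i. (\<And>i. i \<in> I \<Longrightarrow> \<bar>u i\<bar> \<le> r) \<Longrightarrow> i \<in> I \<Longrightarrow> \<bar>u i\<bar> \<le> a * r + d"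
    and i: "i \<in> I"
  shows "\<bar>u i\<bar> \<le> d / (1 - a)"
proof -
  define r where "r = Max ((\<lambda>i. \<bar>u i\<bar>) ` I)"
  have le_r: "\<bar>u i\<bar> \<le> r" if "i \<in> I" for i
    unfolding r_def using fin that by simp
  have "r \<in> (\<lambda>i. \<bar>u i\<bar>) ` I"
    unfolding r_def using fin i by (intro Max_in) auto
  then obtain k where k: "k \<in> I" "r = \<bar>u k\<bar>"
    by auto
  have "r \<le> a * r + d"
    using improve[OF le_r k(1)] k(2) by simp
  then have "r * (1 - a) \<le> d"
    by (simp add: algebra_simps)
  then have "r \<le> d / (1 - a)"
    using a by (simp add: pos_le_divide_eq)
  then show ?thesis
    using le_r[OF i] by simp
qed

lemma abs_sum_mult_le:
  fixes a u :: "'i \<Rightarrow> real"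
  assumes "(\<Sum>j\<in>I. \<bar>a j\<bar>) \<le> q" "\<And>j. j \<in> I \<Longrightarrow> \<bar>u j\<bar> \<le> r" "0 \<le> r"
  shows "\<bar>\<Sum>j\<in>I. a j * u j\<bar> \<le> q * r"
proof -
  have "\<bar>\<Sum>j\<in>I. a j * u j\<bar> \<le> (\<Sum>j\<in>I. \<bar>a j\<bar> * \<bar>u j\<bar>)"
    using sum_abs[of "\<lambda>j. a j * u j" I] by (simp add: abs_mult)
  also have "\<dots> \<le> (\<Sum>j\<in>I. \<bar>a j\<bar> * r)"
    using assms by (intro sum_mono mult_left_mono) auto
  also have "\<dots> \<le> q * r"
    unfolding sum_distrib_right[symmetric] using assms by (intro mult_right_mono) auto
  finally show ?thesis .
qed

text \<open>A solution of the homogeneous system satisfies \<open>u = - A u\<close>, so its maximum norm cannot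
  exceed \<open>q\<close> times itself.\<close>

lemma contractive_homogeneous_zero:
  fixes u :: "'i \<Rightarrow> real"
  assumes fin: "finite I" and q: "q < 1"
    and row: "\<And>i. i \<in> I \<Longrightarrow> (\<Sum>j\<in>I. \<bar>a i j\<bar>) \<le> q"
    and hom: "\<And>i. i \<in> I \<Longrightarrow> u i + (\<Sum>j\<in>I. a i j * u j) = 0"
    and i: "i \<in> I"
  shows "u i = 0"
proof -
  have "\<bar>u i\<bar> \<le> 0 / (1 - q)"
  proof (rule self_improving_sup_bound[OF fin q _ i])
    fix r i assume le: "\<And>i. i \<in> I \<Longrightarrow> \<bar>u i\<bar> \<le> r" and i: "i \<in> I"
    have "0 \<le> r"
      using le[OF i] by simp
    then have "\<bar>\<Sum>j\<in>I. a i j * u j\<bar> \<le> q * r"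
      using row[OF i] le by (intro abs_sum_mult_le)
    then show "\<bar>u i\<bar> \<le> q * r + 0"
      using hom[OF i] by linarith
  qed
  then show ?thesis by simp
qed

lemma nystrom_block_carrier [simp]: "nystrom_block \<theta> r z n x w K \<in> carrier_mat r n"
  and dim_row_nystrom_block [simp]: "dim_row (nystrom_block \<theta> r z n x w K) = r"
  and dim_col_nystrom_block [simp]: "dim_col (nystrom_block \<theta> r z n x w K) = n"
  by (auto simp: nystrom_block_def)

lemma nystrom_block_mult_vec:
  assumes "i < r" "u \<in> carrier_vec n"
  shows "(nystrom_block \<theta> r z n x w K *\<^sub>v u) $ i = (\<Sum>j<n. \<theta> * w j * K (x j) (z i) * u $ j)"
  using assms by (auto simp: nystrom_block_def scalar_prod_def lessThan_atLeast0)

lemma one_plus_nystrom_block_mult_vec: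
  assumes "i < n" "u \<in> carrier_vec n"
  shows "((1\<^sub>m n + nystrom_block \<theta> n z n x w K) *\<^sub>v u) $ i
    = u $ i + (\<Sum>j<n. \<theta> * w j * K (x j) (z i) * u $ j)"
proof -
  have "(1\<^sub>m n + nystrom_block \<theta> n z n x w K) *\<^sub>v u
      = 1\<^sub>m n *\<^sub>v u + nystrom_block \<theta> n z n x w K *\<^sub>v u"
    using assms by (intro add_mult_distrib_mat_vec) auto
  then show ?thesis
    using assms by (simp add: nystrom_block_mult_vec[OF assms] del: index_mult_mat_vec)
qed

lemma one_plus_nystrom_block_inverse:
  assumes q: "q < 1"
    and row: "\<And>i. i < n \<Longrightarrow> (\<Sum>j<n. \<bar>\<theta> * w j * K (x j) (z i)\<bar>) \<le> q"
  shows "\<exists>B\<in>carrier_mat n n. B * (1\<^sub>m n + nystrom_block \<theta> n z n x w K) = 1\<^sub>m n \<and>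
    (1\<^sub>m n + nystrom_block \<theta> n z n x w K) * B = 1\<^sub>m n"
proof -
  let ?A = "1\<^sub>m n + nystrom_block \<theta> n z n x w K"
  have A: "?A \<in> carrier_mat n n" by simp
  have "v = 0\<^sub>v n" if v: "v \<in> carrier_vec n" and Av: "?A *\<^sub>v v = 0\<^sub>v n" for v
  proof (rule eq_vecI)
    fix i assume "i < dim_vec (0\<^sub>v n :: real vec)"
    then have i: "i < n" by simp
    have "v $ i = 0"
    proof (rule contractive_homogeneous_zero[where I = "{..<n}" and q = q
          and a = "\<lambda>i j. \<theta> * w j * K (x j) (z i)" and u = "\<lambda>i. v $ i"])
      fix i assume "i \<in> {..<n}"
      then have "i < n" by simp
      then show "v $ i + (\<Sum>j<n. \<theta> * w j * K (x j) (z i) * v $ j) = 0"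
        using one_plus_nystrom_block_mult_vec[OF \<open>i < n\<close> v, of \<theta> z x w K] Av by simp
    qed (use q row i in auto)
    then show "v $ i = 0\<^sub>v n $ i" using i by simp
  qed (use v in simp)
  then have "det ?A \<noteq> 0"
    using det_0_iff_vec_prod_zero[OF A] by auto
  from det_non_zero_imp_unit[OF A this] show ?thesis
    by (auto simp: Units_def ring_mat_def)
qed

lemma invertible_one_plus_nystrom_block:
  assumes q: "q < 1"
    and row: "\<And>i. i < n \<Longrightarrow> (\<Sum>j<n. \<bar>\<theta> * w j * K (x j) (z i)\<bar>) \<le> q"
  shows "invertible_mat (1\<^sub>m n + nystrom_block \<theta> n z n x w K)"
proof -
  have "\<exists>B\<in>carrier_mat n n. B * (1\<^sub>m n + nystrom_block \<theta> n z n x w K) = 1\<^sub>m n \<and>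
      (1\<^sub>m n + nystrom_block \<theta> n z n x w K) * B = 1\<^sub>m n"
    by (rule one_plus_nystrom_block_inverse[OF q]) (rule row)
  then show ?thesis
    by (auto simp: invertible_mat_def inverts_mat_def)
qed

section \<open>Nystroem interpolants\<close>

text \<open>The interpolation equation on all of \<open>D\<close> is equivalent to the linear system at the nodes:
  a nodal solution \<open>u\<close> is extended to \<open>D\<close> by solving the equation for its first term.\<close>

lemma nystrom_interpolant_exists:
  fixes w x :: "nat \<Rightarrow> real"
  assumes q: "q < 1"
    and row: "\<And>y. y \<in> D \<Longrightarrow> (\<Sum>j<n. \<bar>w j * K (x j) y\<bar>) \<le> q"
    and nodes: "\<And>j. j < n \<Longrightarrow> x j \<in> D"
  shows "\<exists>f. \<forall>y\<in>D. f y + (\<Sum>j<n. w j * K (x j) y * f (x j)) = g y"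
proof -
  let ?A = "1\<^sub>m n + nystrom_block 1 n x n x w K"
  have "\<exists>B\<in>carrier_mat n n. B * ?A = 1\<^sub>m n \<and> ?A * B = 1\<^sub>m n"
    using q row nodes by (intro one_plus_nystrom_block_inverse) auto
  then obtain B where B: "B \<in> carrier_mat n n" "?A * B = 1\<^sub>m n"
    by auto
  define u where "u = B *\<^sub>v vec n (\<lambda>i. g (x i))"
  have u: "u \<in> carrier_vec n"
    unfolding u_def using B(1) by simp
  have Au: "?A *\<^sub>v u = vec n (\<lambda>i. g (x i))"
    unfolding u_def using B by (subst assoc_mult_mat_vec[symmetric, of _ n n _ n]) auto
  define f where "f y = g y - (\<Sum>j<n. w j * K (x j) y * u $ j)" for y
  have fx: "f (x i) = u $ i" if "i < n" for i
    using one_plus_nystrom_block_mult_vec[OF that u, of 1 x x w K] Au that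
    by (simp add: f_def)
  show ?thesis
  proof (intro exI ballI)
    fix y
    show "f y + (\<Sum>j<n. w j * K (x j) y * f (x j)) = g y"
      by (simp add: fx) (simp add: f_def)
  qed
qed

lemma nystrom_interpolant_unique:
  fixes w x :: "nat \<Rightarrow> real"
  assumes q: "q < 1"
    and row: "\<And>y. y \<in> D \<Longrightarrow> (\<Sum>j<n. \<bar>w j * K (x j) y\<bar>) \<le> q"
    and nodes: "\<And>j. j < n \<Longrightarrow> x j \<in> D"
    and f: "\<And>y. y \<in> D \<Longrightarrow> f y + (\<Sum>j<n. w j * K (x j) y * f (x j)) = g y"
    and h: "\<And>y. y \<in> D \<Longrightarrow> h y + (\<Sum>j<n. w j * K (x j) y * h (x j)) = g y"
    and y: "y \<in> D"
  shows "h y = f y"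
proof -
  have diff: "(h y - f y) + (\<Sum>j<n. w j * K (x j) y * (h (x j) - f (x j))) = 0" if "y \<in> D" for y
    using f[OF that] h[OF that] by (simp add: right_diff_distrib sum_subtractf)
  have "h (x i) - f (x i) = 0" if "i < n" for i
    by (rule contractive_homogeneous_zero[where I = "{..<n}" and q = q
          and a = "\<lambda>i j. w j * K (x j) (x i)" and u = "\<lambda>i. h (x i) - f (x i)"])
       (use q row nodes diff that in auto)
  then show ?thesis
    using diff[OF y] by simp
qed

section \<open>Convergence of the block iteration\<close>

text \<open>With \<open>a\<close> and \<open>d\<close> bounding the two parts of the discretized operator, one sweep multiplies
  the error by at most \<open>a + d\<close>. The implicit half step contributes the factor
  \<open>d / (1 - a) \<le> a + d\<close>, and since this is below one the explicit half step sees no error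
  larger than the previous one.\<close>

lemma block_iteration_converges:
  fixes x w x' w' :: "nat \<Rightarrow> real"
  assumes a: "0 \<le> a" and d: "0 \<le> d" and ad: "a + d < 1"
    and row: "\<And>y. y \<in> D \<Longrightarrow> (\<Sum>j<m. \<bar>\<theta> * w j * K (x j) y\<bar>) \<le> a"
    and row': "\<And>y. y \<in> D \<Longrightarrow> (\<Sum>j<n. \<bar>\<theta>' * w' j * K (x' j) y\<bar>) \<le> d"
    and nodes: "\<And>j. j < m \<Longrightarrow> x j \<in> D" and nodes': "\<And>j. j < n \<Longrightarrow> x' j \<in> D"
    and f: "\<And>y. y \<in> D \<Longrightarrow> f y + (\<Sum>j<m. \<theta> * w j * K (x j) y * f (x j))
      + (\<Sum>j<n. \<theta>' * w' j * K (x' j) y * f (x' j)) = g y"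
    and c0: "c0 \<in> carrier_vec n"
    and iter: "is_block_iteration m
      (nystrom_block \<theta> m x m x w K) (nystrom_block \<theta>' m x n x' w' K)
      (nystrom_block \<theta> n x' m x w K) (nystrom_block \<theta>' n x' n x' w' K)
      (vec m (\<lambda>i. g (x i))) (vec n (\<lambda>i. g (x' i))) c0 b c"
  shows "vec_tendsto m b (vec m (\<lambda>i. f (x i)))" "vec_tendsto n c (vec n (\<lambda>i. f (x' i)))"
proof -
  define \<rho> where "\<rho> = a + d"
  have \<rho>: "0 \<le> \<rho>" "\<rho> < 1"
    using a d ad by (auto simp: \<rho>_def)
  have b: "b (Suc k) \<in> carrier_vec m" for k
    using iter by (simp add: is_block_iteration_def)
  have c: "c k \<in> carrier_vec n" for k
  proof (cases k)
    case 0
    then show ?thesis using iter c0 by (simp add: is_block_iteration_def)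
  next
    case (Suc l)
    have "c (Suc l) = vec n (\<lambda>i. g (x' i)) - nystrom_block \<theta> n x' m x w K *\<^sub>v b (Suc l)
        - nystrom_block \<theta>' n x' n x' w' K *\<^sub>v c l"
      using iter by (simp add: is_block_iteration_def)
    then have "dim_vec (c (Suc l)) = n"
      by (simp only: index_minus_vec(2) dim_mult_mat_vec dim_row_nystrom_block)
    then show ?thesis
      unfolding Suc by (rule carrier_vecI)
  qed
  define eb where "eb k i = b k $ i - f (x i)" for k i
  define ec where "ec k i = c k $ i - f (x' i)" for k i
  have eb_eq: "eb (Suc k) i = - (\<Sum>j<m. \<theta> * w j * K (x j) (x i) * eb (Suc k) j)
      - (\<Sum>j<n. \<theta>' * w' j * K (x' j) (x i) * ec k j)" if i: "i < m" for k i
  proof -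
    have "((1\<^sub>m m + nystrom_block \<theta> m x m x w K) *\<^sub>v b (Suc k)) $ i
        = (vec m (\<lambda>i. g (x i)) - nystrom_block \<theta>' m x n x' w' K *\<^sub>v c k) $ i"
      using iter by (simp add: is_block_iteration_def)
    then have "b (Suc k) $ i + (\<Sum>j<m. \<theta> * w j * K (x j) (x i) * b (Suc k) $ j)
        = g (x i) - (\<Sum>j<n. \<theta>' * w' j * K (x' j) (x i) * c k $ j)"
      using i b[of k] c[of k]
      by (simp add: one_plus_nystrom_block_mult_vec nystrom_block_mult_vec del: index_mult_mat_vec)
    then show ?thesis
      using f[OF nodes[OF i]] by (simp add: eb_def ec_def right_diff_distrib sum_subtractf)
  qed
  have ec_eq: "ec (Suc k) i = - (\<Sum>j<m. \<theta> * w j * K (x j) (x' i) * eb (Suc k) j)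
      - (\<Sum>j<n. \<theta>' * w' j * K (x' j) (x' i) * ec k j)" if i: "i < n" for k i
  proof -
    have "c (Suc k) = vec n (\<lambda>i. g (x' i)) - nystrom_block \<theta> n x' m x w K *\<^sub>v b (Suc k)
        - nystrom_block \<theta>' n x' n x' w' K *\<^sub>v c k"
      using iter by (simp add: is_block_iteration_def)
    then have "c (Suc k) $ i = g (x' i) - (\<Sum>j<m. \<theta> * w j * K (x j) (x' i) * b (Suc k) $ j)
        - (\<Sum>j<n. \<theta>' * w' j * K (x' j) (x' i) * c k $ j)"
      using i b[of k] c[of k] by (simp add: nystrom_block_mult_vec del: index_mult_mat_vec)
    then show ?thesis
      using f[OF nodes'[OF i]] by (simp add: eb_def ec_def right_diff_distrib sum_subtractf)
  qed
  have eb_step: "\<bar>eb (Suc k) i\<bar> \<le> \<rho> * r"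
    if r: "0 \<le> r" and le: "\<And>j. j < n \<Longrightarrow> \<bar>ec k j\<bar> \<le> r" and i: "i < m" for k r i
  proof -
    have "\<bar>eb (Suc k) i\<bar> \<le> (d * r) / (1 - a)"
    proof (rule self_improving_sup_bound[where I = "{..<m}"])
      fix s i assume s: "\<And>i. i \<in> {..<m} \<Longrightarrow> \<bar>eb (Suc k) i\<bar> \<le> s" and i: "i \<in> {..<m}"
      have "0 \<le> s"
        using s[OF i] by simp
      then have "\<bar>\<Sum>j<m. \<theta> * w j * K (x j) (x i) * eb (Suc k) j\<bar> \<le> a * s"
        using s i by (intro abs_sum_mult_le row nodes) auto
      moreover have "\<bar>\<Sum>j<n. \<theta>' * w' j * K (x' j) (x i) * ec k j\<bar> \<le> d * r"
        using r le i by (intro abs_sum_mult_le row' nodes) auto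
      ultimately show "\<bar>eb (Suc k) i\<bar> \<le> a * s + d * r"
        using eb_eq[of i k] i by simp
    qed (use i ad d in auto)
    also have "\<dots> \<le> \<rho> * r"
    proof -
      have "0 \<le> a * (1 - (a + d))"
        using a ad by (intro mult_nonneg_nonneg) auto
      then have "d \<le> \<rho> * (1 - a)"
        by (simp add: \<rho>_def algebra_simps)
      then have "d * r \<le> \<rho> * (1 - a) * r"
        using r by (rule mult_right_mono)
      then show ?thesis
        using ad d by (simp add: pos_divide_le_eq algebra_simps)
    qed
    finally show ?thesis .
  qed
  have ec_step: "\<bar>ec (Suc k) i\<bar> \<le> \<rho> * r"
    if r: "0 \<le> r" and le: "\<And>j. j < n \<Longrightarrow> \<bar>ec k j\<bar> \<le> r" and i: "i < n" for k r i
  proof -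
    have "\<bar>eb (Suc k) j\<bar> \<le> r" if "j < m" for j
      using eb_step[OF r le that] mult_right_mono[of \<rho> 1 r] \<rho> r by simp
    then have "\<bar>\<Sum>j<m. \<theta> * w j * K (x j) (x' i) * eb (Suc k) j\<bar> \<le> a * r"
      using r i by (intro abs_sum_mult_le row nodes') auto
    moreover have "\<bar>\<Sum>j<n. \<theta>' * w' j * K (x' j) (x' i) * ec k j\<bar> \<le> d * r"
      using r le i by (intro abs_sum_mult_le row' nodes') auto
    ultimately show ?thesis
      using ec_eq[OF i, of k] by (simp add: \<rho>_def distrib_right)
  qed
  define C where "C = (\<Sum>j<n. \<bar>ec 0 j\<bar>)"
  have C: "0 \<le> C"
    by (simp add: C_def sum_nonneg)
  have ec_bound: "\<bar>ec k i\<bar> \<le> \<rho> ^ k * C" if "i < n" for k i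
    using that
  proof (induction k arbitrary: i)
    case 0
    have "\<bar>ec 0 i\<bar> \<le> C"
      unfolding C_def using 0 by (intro member_le_sum) auto
    then show ?case by simp
  next
    case (Suc k)
    then show ?case
      using ec_step[of "\<rho> ^ k * C" k i] \<rho> C by (simp add: mult.assoc)
  qed
  have eb_bound: "\<bar>eb (Suc k) i\<bar> \<le> \<rho> ^ Suc k * C" if "i < m" for k i
    using eb_step[of "\<rho> ^ k * C" k i] ec_bound that \<rho> C by (simp add: mult.assoc)
  have lim: "(\<lambda>k. \<rho> ^ k * C) \<longlonglongrightarrow> 0"
    using \<rho> by (intro tendsto_mult_left_zero LIMSEQ_realpow_zero) auto
  show "vec_tendsto n c (vec n (\<lambda>i. f (x' i)))"
    unfolding vec_tendsto_def
  proof (intro allI impI)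
    fix i assume i: "i < n"
    have "(\<lambda>k. ec k i) \<longlonglongrightarrow> 0"
      using ec_bound[OF i] by (intro Lim_null_comparison[OF _ lim] always_eventually) auto
    then show "(\<lambda>k. c k $ i) \<longlonglongrightarrow> vec n (\<lambda>i. f (x' i)) $ i"
      using i by (simp add: ec_def LIM_zero_iff)
  qed
  show "vec_tendsto m b (vec m (\<lambda>i. f (x i)))"
    unfolding vec_tendsto_def
  proof (intro allI impI)
    fix i assume i: "i < m"
    have "\<forall>\<^sub>F k in sequentially. norm (eb (Suc k) i) \<le> \<rho> ^ Suc k * C"
      by (intro always_eventually allI) (simp only: real_norm_def eb_bound[OF i])
    then have "(\<lambda>k. eb (Suc k) i) \<longlonglongrightarrow> 0"
      using LIMSEQ_Suc[OF lim] by (rule Lim_null_comparison)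
    then have "(\<lambda>k. b (Suc k) $ i) \<longlonglongrightarrow> f (x i)"
      by (simp add: eb_def LIM_zero_iff)
    then show "(\<lambda>k. b k $ i) \<longlonglongrightarrow> vec m (\<lambda>i. f (x i)) $ i"
      using i by (simp add: filterlim_sequentially_Suc[of "\<lambda>k. b k $ i"])
  qed
qed

section \<open>Mass and positivity of the two rules\<close>

lemma set_integral_square_nonneg: "0 \<le> (LINT t:D|\<mu>. (h t)\<^sup>2 :: real)"
  unfolding set_lebesgue_integral_def by (intro Bochner_Integration.integral_nonneg) simp

lemma sqnorm_op_nonneg: "0 \<le> sqnorm_op \<mu> D n"
  using set_integral_square_nonneg[of \<mu> D "poly (monic_op \<mu> D n)"]
  by (simp add: sqnorm_op_def inner_mu_def power2_eq_square)

lemma beta_nonneg: "0 \<le> beta \<mu> D n"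
  by (simp add: beta_def sqnorm_op_nonneg)

lemma theta_nonneg: "0 \<le> theta1 \<mu> D m" "0 \<le> theta2 \<mu> D m"
  by (simp_all add: theta1_def theta2_def beta_nonneg)

text \<open>Only an inequality, because both quotients are \<open>0\<close> when their denominator vanishes.\<close>

lemma theta_sum_le_one: "theta1 \<mu> D m + theta2 \<mu> D m \<le> 1"
proof (cases "beta \<mu> D m + beta \<mu> D (Suc m) = 0")
  case False
  then show ?thesis
    by (simp add: theta1_def theta2_def add_divide_distrib[symmetric] add.commute)
qed (simp add: theta1_def theta2_def)

lemma monic_op_0: "monic_op \<mu> D 0 = 1"
  unfolding monic_op_def
proof (rule the_equality)
  fix p :: "real poly"
  assume "degree p = 0 \<and> lead_coeff p = 1 \<and>
    (\<forall>q. degree q < 0 \<longrightarrow> inner_mu \<mu> D (poly p) (poly q) = 0)"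
  then show "p = 1"
    by (auto elim!: degree_eq_zeroE simp: one_pCons)
qed simp

lemma beta_0: "beta \<mu> D 0 = (LINT t:D|\<mu>. 1)"
  by (simp add: beta_def sqnorm_op_def inner_mu_def monic_op_0)

lemma gauss_weights_sum:
  assumes "is_gauss_rule \<mu> D m x w" "0 < m"
  shows "(\<Sum>j<m. w j) = beta \<mu> D 0"
proof -
  have "(\<Sum>j<m. w j * poly 1 (x j)) = (LINT t:D|\<mu>. poly 1 t)"
    using assms unfolding is_gauss_rule_def by (metis degree_1 mult_pos_pos zero_less_numeral)
  then show ?thesis
    by (simp add: beta_0)
qed

text \<open>The square of the nodal polynomial that omits \<open>x\<^sub>j\<close> has degree \<open>2 (m - 1)\<close>, so the rule
  integrates it exactly, and it isolates the weight \<open>w\<^sub>j\<close>.\<close>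

lemma gauss_weights_nonneg:
  assumes rule: "is_gauss_rule \<mu> D m x w" and j: "j < m"
  shows "0 \<le> w j"
proof -
  define l where "l = (\<Prod>i\<in>{..<m} - {j}. [:- x i, 1:])"
  have poly_l: "poly l t = (\<Prod>i\<in>{..<m} - {j}. t - x i)" for t
    by (simp add: l_def poly_prod)
  have "degree l \<le> (\<Sum>i\<in>{..<m} - {j}. 1)"
    unfolding l_def by (rule order_trans[OF degree_prod_sum_le]) auto
  then have "degree (l\<^sup>2) < 2 * m"
    using j degree_power_le[of l 2] by simp
  then have "(\<Sum>i<m. w i * poly (l\<^sup>2) (x i)) = (LINT t:D|\<mu>. poly (l\<^sup>2) t)"
    using rule unfolding is_gauss_rule_def by blast
  also have "(\<Sum>i<m. w i * poly (l\<^sup>2) (x i)) = w j * (poly l (x j))\<^sup>2"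
  proof -
    have "poly l (x i) = 0" if "i \<in> {..<m} - {j}" for i
      unfolding poly_l using that by (intro prod_zero) auto
    then show ?thesis
      using j by (subst sum.remove[of _ j]) auto
  qed
  also have "(LINT t:D|\<mu>. poly (l\<^sup>2) t) \<ge> 0"
    using set_integral_square_nonneg[of \<mu> D "poly l"] by simp
  finally have "0 \<le> w j * (poly l (x j))\<^sup>2" .
  moreover have "0 < (poly l (x j))\<^sup>2"
    using rule j by (auto simp: poly_l is_gauss_rule_def inj_on_def)
  ultimately show ?thesis
    by (simp add: zero_le_mult_iff)
qed

lemma jacobi_star_mat_carrier: "jacobi_star_mat \<mu> D m \<in> carrier_mat (Suc m) (Suc m)"
  unfolding jacobi_star_mat_def Let_def
  by (rule carrier_matI) (simp_all add: jacobi_mat_def)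

lemma jacobi_star_mat_symmetric: "(jacobi_star_mat \<mu> D m)\<^sup>T = jacobi_star_mat \<mu> D m"
proof -
  have "(jacobi_mat \<mu> D m)\<^sup>T = jacobi_mat \<mu> D m"
    by (rule eq_matI) (auto simp: jacobi_mat_def)
  moreover have "(mat 1 1 (\<lambda>_. alpha \<mu> D m))\<^sup>T = mat 1 1 (\<lambda>_. alpha \<mu> D m)"
    by (rule eq_matI) auto
  ultimately show ?thesis
    unfolding jacobi_star_mat_def Let_def
    by (subst transpose_four_block_mat[of _ m m _ 1 _ 1])
       (auto simp: jacobi_mat_def transpose_mat_of_rows transpose_mat_of_cols)
qed

lemma symmetric_eigenvectors_orthogonal:
  fixes A :: "real mat" and u v :: "real vec"
  assumes A: "A \<in> carrier_mat n n" and sym: "A\<^sup>T = A"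
    and v: "eigenvector A v s" and u: "eigenvector A u t" and st: "s \<noteq> t"
  shows "v \<bullet> u = 0"
proof -
  have vc: "v \<in> carrier_vec n" and uc: "u \<in> carrier_vec n"
    using u v A by (auto simp: eigenvector_def)
  have "s * (v \<bullet> u) = (A *\<^sub>v v) \<bullet> u"
    using v vc uc by (simp add: eigenvector_def)
  also have "\<dots> = v \<bullet> (A *\<^sub>v u)"
    using transpose_vec_mult_scalar[OF A uc vc] sym by simp
  also have "\<dots> = t * (v \<bullet> u)"
    using u vc uc by (simp add: eigenvector_def)
  finally show ?thesis
    using st by simp
qed

text \<open>The matrix \<open>V\<close> of eigenvectors satisfies \<open>V\<^sup>T V = 1\<close>, hence also \<open>V V\<^sup>T = 1\<close>, whose
  diagonal entries are the squared norms of the rows of \<open>V\<close>.\<close>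

lemma symmetric_eigenvector_rows_normalized:
  fixes A :: "real mat" and v :: "nat \<Rightarrow> real vec"
  assumes A: "A \<in> carrier_mat n n" and sym: "A\<^sup>T = A"
    and inj: "inj_on x {..<n}"
    and eig: "\<And>j. j < n \<Longrightarrow> eigenvector A (v j) (x j)"
    and unit: "\<And>j. j < n \<Longrightarrow> v j \<bullet> v j = 1"
    and i: "i < n"
  shows "(\<Sum>j<n. (v j $ i)\<^sup>2) = 1"
proof -
  define V where "V = mat n n (\<lambda>(i, j). v j $ i)"
  have V: "V \<in> carrier_mat n n"
    by (simp add: V_def)
  have vc: "v j \<in> carrier_vec n" if "j < n" for j
    using eig[OF that] A by (simp add: eigenvector_def)
  have col: "col V j = v j" if "j < n" for j
    using vc[OF that] that by (intro eq_vecI) (auto simp: V_def)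
  have "V\<^sup>T * V = 1\<^sub>m n"
  proof (rule eq_matI)
    fix k l assume "k < dim_row (1\<^sub>m n :: real mat)" "l < dim_col (1\<^sub>m n :: real mat)"
    then have kl: "k < n" "l < n" by auto
    have "v k \<bullet> v l = (if k = l then 1 else 0)"
    proof (cases "k = l")
      case False
      then have "x k \<noteq> x l"
        using inj kl by (auto simp: inj_on_def)
      then show ?thesis
        using symmetric_eigenvectors_orthogonal[OF A sym eig[OF kl(1)] eig[OF kl(2)]] False by simp
    qed (use unit kl in simp)
    then show "(V\<^sup>T * V) $$ (k, l) = 1\<^sub>m n $$ (k, l)"
      using kl V by (simp add: col)
  qed (use V in auto)
  then have "V * V\<^sup>T = 1\<^sub>m n"
    using V by (intro mat_mult_left_right_inverse[of "V\<^sup>T"]) auto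
  then have "(V * V\<^sup>T) $$ (i, i) = 1"
    using i by simp
  then show ?thesis
    using i by (simp add: V_def scalar_prod_def lessThan_atLeast0 power2_eq_square)
qed

lemma star_weights_nonneg:
  assumes "is_star_rule \<mu> D m x w" "j < Suc m"
  shows "0 \<le> w j"
  using assms beta_nonneg[of \<mu> D 0] by (auto simp: is_star_rule_def)

lemma star_weights_sum:
  assumes rule: "is_star_rule \<mu> D m x w"
  shows "(\<Sum>j<Suc m. w j) = beta \<mu> D 0"
proof -
  obtain v :: "nat \<Rightarrow> real vec" where v: "\<And>j. j < Suc m \<Longrightarrow> eigenvector (jacobi_star_mat \<mu> D m) (v j) (x j)"
      "\<And>j. j < Suc m \<Longrightarrow> v j \<bullet> v j = 1" "\<And>j. j < Suc m \<Longrightarrow> w j = beta \<mu> D 0 * (v j $ 0)\<^sup>2"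
    using rule unfolding is_star_rule_def by metis
  have "inj_on x {..<Suc m}"
    using rule by (auto simp: is_star_rule_def bij_betw_def)
  then have "(\<Sum>j<Suc m. (v j $ 0)\<^sup>2) = 1"
    using v by (intro symmetric_eigenvector_rows_normalized[OF jacobi_star_mat_carrier
          jacobi_star_mat_symmetric]) auto
  moreover have "(\<Sum>j<Suc m. w j) = (\<Sum>j<Suc m. beta \<mu> D 0 * (v j $ 0)\<^sup>2)"
    by (rule sum.cong) (simp_all add: v(3))
  ultimately show ?thesis
    by (simp only: sum_distrib_left[symmetric] mult_1_right)
qed

section \<open>The averaged rule\<close>

lemma kernel_bound:
  assumes kernel: "kernel_norm D K < ereal (inverse \<beta>)" and \<beta>: "0 \<le> \<beta>" and D: "D \<noteq> {}"
  obtains \<kappa> where "0 \<le> \<kappa>" "\<kappa> * \<beta> < 1" "\<And>x y. x \<in> D \<Longrightarrow> y \<in> D \<Longrightarrow> \<bar>K x y\<bar> \<le> \<kappa>"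
proof -
  have le: "ereal \<bar>K x y\<bar> \<le> kernel_norm D K" if "x \<in> D" "y \<in> D" for x y
    unfolding kernel_norm_def by (rule SUP_upper2[OF that(2)], rule SUP_upper[OF that(1)])
  obtain z where z: "z \<in> D"
    using D by auto
  have ge: "0 \<le> kernel_norm D K"
    using le[OF z z] by (meson abs_ge_zero ereal_less_eq(5) order_trans)
  then obtain \<kappa> where \<kappa>: "kernel_norm D K = ereal \<kappa>"
    using kernel by (cases "kernel_norm D K") auto
  show ?thesis
  proof (rule that)
    show "0 \<le> \<kappa>" using ge \<kappa> by simp
    show "\<bar>K x y\<bar> \<le> \<kappa>" if "x \<in> D" "y \<in> D" for x y
      using le[OF that] \<kappa> by simp
    \<comment> \<open>For \<open>\<beta> = 0\<close> the bound is trivial, whatever \<open>inverse 0\<close> denotes.\<close>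
    show "\<kappa> * \<beta> < 1"
      using kernel \<kappa> \<beta> by (cases "\<beta> = 0") (auto simp: field_simps)
  qed
qed

lemma weighted_kernel_row_bound:
  fixes w x :: "nat \<Rightarrow> real"
  assumes "0 \<le> \<theta>" "\<And>j. j < n \<Longrightarrow> 0 \<le> w j" "\<And>j. j < n \<Longrightarrow> \<bar>K (x j) y\<bar> \<le> \<kappa>"
  shows "(\<Sum>j<n. \<bar>\<theta> * w j * K (x j) y\<bar>) \<le> \<theta> * (\<kappa> * (\<Sum>j<n. w j))"
proof -
  have "(\<Sum>j<n. \<bar>\<theta> * w j * K (x j) y\<bar>) \<le> (\<Sum>j<n. \<theta> * w j * \<kappa>)"
    using assms by (intro sum_mono) (auto simp: abs_mult intro!: mult_left_mono)
  also have "\<dots> = \<theta> * (\<kappa> * (\<Sum>j<n. w j))"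
    by (simp add: sum_distrib_left algebra_simps)
  finally show ?thesis .
qed

lemma sum_lessThan_add:
  fixes h :: "nat \<Rightarrow> 'a::comm_monoid_add"
  shows "(\<Sum>j<m + n. h j) = (\<Sum>j<m. h j) + (\<Sum>j<n. h (m + j))"
  by (induction n) (simp_all add: add.assoc)

text \<open>The averaged interpolant is the ordinary Nystroem interpolant of the concatenated rule,
  in which the weights carry the averaging factors.\<close>

lemma averaged_interpolant_exists_unique:
  fixes xG wG xS wS :: "nat \<Rightarrow> real"
  assumes ad: "a + d < 1"
    and row: "\<And>y. y \<in> D \<Longrightarrow> (\<Sum>j<m. \<bar>theta1 \<mu> D m * wG j * K (xG j) y\<bar>) \<le> a"
    and row': "\<And>y. y \<in> D \<Longrightarrow> (\<Sum>j<Suc m. \<bar>theta2 \<mu> D m * wS j * K (xS j) y\<bar>) \<le> d"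
    and nodes: "\<And>j. j < m \<Longrightarrow> xG j \<in> D" "\<And>j. j < Suc m \<Longrightarrow> xS j \<in> D"
  shows "\<exists>f. is_averaged_interpolant \<mu> D m xG wG xS wS K g f \<and>
    (\<forall>h. is_averaged_interpolant \<mu> D m xG wG xS wS K g h \<longrightarrow> (\<forall>y\<in>D. h y = f y))"
proof -
  define x where "x j = (if j < m then xG j else xS (j - m))" for j
  define w where "w j = (if j < m then theta1 \<mu> D m * wG j else theta2 \<mu> D m * wS (j - m))" for j
  have split: "(\<Sum>j<m + Suc m. H (w j) (x j)) =
      (\<Sum>j<m. H (theta1 \<mu> D m * wG j) (xG j)) + (\<Sum>j<Suc m. H (theta2 \<mu> D m * wS j) (xS j))"
    for H :: "real \<Rightarrow> real \<Rightarrow> real"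
    unfolding sum_lessThan_add by (simp add: x_def w_def)
  have eq: "is_averaged_interpolant \<mu> D m xG wG xS wS K g h \<longleftrightarrow>
      (\<forall>y\<in>D. h y + (\<Sum>j<m + Suc m. w j * K (x j) y * h (x j)) = g y)" for h
    unfolding is_averaged_interpolant_def split[of "\<lambda>w x. w * K x y * h x" for y]
    by (simp only: sum_distrib_left mult.assoc add.assoc)
  have rows: "(\<Sum>j<m + Suc m. \<bar>w j * K (x j) y\<bar>) \<le> a + d" if "y \<in> D" for y
    using add_mono[OF row[OF that] row'[OF that]]
    unfolding split[of "\<lambda>w x. \<bar>w * K x y\<bar>"] .
  have x: "x j \<in> D" if "j < m + Suc m" for j
    using nodes that by (auto simp: x_def)
  have "\<exists>f. \<forall>y\<in>D. f y + (\<Sum>j<m + Suc m. w j * K (x j) y * f (x j)) = g y"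
    by (rule nystrom_interpolant_exists[OF ad]) (fact rows, fact x)
  then obtain f where f: "\<forall>y\<in>D. f y + (\<Sum>j<m + Suc m. w j * K (x j) y * f (x j)) = g y"
    by blast
  show ?thesis
  proof (intro exI[of _ f] conjI allI impI ballI)
    show "is_averaged_interpolant \<mu> D m xG wG xS wS K g f"
      unfolding eq using f by blast
    fix h y assume "is_averaged_interpolant \<mu> D m xG wG xS wS K g h" and y: "y \<in> D"
    then have h: "\<forall>y\<in>D. h y + (\<Sum>j<m + Suc m. w j * K (x j) y * h (x j)) = g y"
      unfolding eq by blast
    show "h y = f y"
      by (rule nystrom_interpolant_unique[where w = w and x = x and h = h and f = f and D = D
            and n = "m + Suc m" and K = K and g = g and q = "a + d"])
        (use ad rows x f h y in \<open>blast+\<close>)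
  qed
qed

section \<open>The convergence theorem\<close>

theorem theorem5p3:
  fixes \<mu> :: "real measure" and D :: "real set"
    and K :: "real \<Rightarrow> real \<Rightarrow> real" and g :: "real \<Rightarrow> real"
  assumes interval: "is_interval D"
    and borel: "sets \<mu> = sets borel"
    and supported: "emeasure \<mu> (- D) = 0"
    and infinite_support: "infinite (measure_support \<mu>)"
    and moments: "\<And>n::nat. integrable \<mu> (\<lambda>x. x ^ n)"
    and kernel: "kernel_norm D K < ereal (inverse (beta \<mu> D 0))"
  shows "\<exists>M::nat. \<forall>m\<ge>M. \<forall>xG wG xS wS.
    is_gauss_rule \<mu> D m xG wG \<longrightarrow> is_star_rule \<mu> D m xS wS \<longrightarrow>
    xG ` {..<m} \<subseteq> D \<longrightarrow> xS ` {..<Suc m} \<subseteq> D \<longrightarrow>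
    (let \<Phi>11 = nystrom_block (theta1 \<mu> D m) m xG m xG wG K;
         \<Phi>12 = nystrom_block (theta2 \<mu> D m) m xG (Suc m) xS wS K;
         \<Phi>21 = nystrom_block (theta1 \<mu> D m) (Suc m) xS m xG wG K;
         \<Phi>22 = nystrom_block (theta2 \<mu> D m) (Suc m) xS (Suc m) xS wS K;
         gG = vec m (\<lambda>i. g (xG i));
         gS = vec (Suc m) (\<lambda>i. g (xS i))
     in invertible_mat (1\<^sub>m m + \<Phi>11) \<and>
        (\<exists>f. is_averaged_interpolant \<mu> D m xG wG xS wS K g f \<and>
          (\<forall>h. is_averaged_interpolant \<mu> D m xG wG xS wS K g h \<longrightarrow> (\<forall>y\<in>D. h y = f y)) \<and>
          (\<forall>c0 \<in> carrier_vec (Suc m). \<forall>b c.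
             is_block_iteration m \<Phi>11 \<Phi>12 \<Phi>21 \<Phi>22 gG gS c0 b c \<longrightarrow>
             vec_tendsto m b (vec m (\<lambda>i. f (xG i))) \<and>
             vec_tendsto (Suc m) c (vec (Suc m) (\<lambda>i. f (xS i))))))"
proof (intro exI[of _ 1] allI impI)
  \<comment> \<open>One node suffices: it makes the Gauss rule exact on constants and shows that \<open>D\<close> is nonempty.\<close>
  fix m :: nat and xG wG xS wS :: "nat \<Rightarrow> real"
  assume "1 \<le> m" and gauss: "is_gauss_rule \<mu> D m xG wG" and star: "is_star_rule \<mu> D m xS wS"
    and D: "xG ` {..<m} \<subseteq> D" "xS ` {..<Suc m} \<subseteq> D"
  let ?t1 = "theta1 \<mu> D m" and ?t2 = "theta2 \<mu> D m"
  have m: "0 < m" using \<open>1 \<le> m\<close> by simp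
  have nodes: "xG j \<in> D" if "j < m" for j
    using D that by auto
  have nodes': "xS j \<in> D" if "j < Suc m" for j
    using D that by auto
  have "D \<noteq> {}"
    using nodes[OF m] by auto
  from kernel_bound[OF kernel beta_nonneg this] obtain \<kappa>
    where \<kappa>: "0 \<le> \<kappa>" "\<kappa> * beta \<mu> D 0 < 1" "\<And>x y. x \<in> D \<Longrightarrow> y \<in> D \<Longrightarrow> \<bar>K x y\<bar> \<le> \<kappa>"
    by blast
  define q where "q = \<kappa> * beta \<mu> D 0"
  have q: "0 \<le> q" "q < 1"
    using \<kappa> beta_nonneg[of \<mu> D 0] by (auto simp: q_def)
  have row: "(\<Sum>j<m. \<bar>?t1 * wG j * K (xG j) y\<bar>) \<le> ?t1 * q" if "y \<in> D" for y
    unfolding q_def gauss_weights_sum[OF gauss m, symmetric]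
    using \<kappa>(3)[OF nodes that] gauss_weights_nonneg[OF gauss] theta_nonneg
    by (intro weighted_kernel_row_bound)
  have row': "(\<Sum>j<Suc m. \<bar>?t2 * wS j * K (xS j) y\<bar>) \<le> ?t2 * q" if "y \<in> D" for y
    unfolding q_def star_weights_sum[OF star, symmetric]
    using \<kappa>(3)[OF nodes' that] star_weights_nonneg[OF star] theta_nonneg
    by (intro weighted_kernel_row_bound)
  have nn: "0 \<le> ?t1 * q" "0 \<le> ?t2 * q"
    using q theta_nonneg by simp_all
  have "?t1 * q + ?t2 * q \<le> 1 * q"
    unfolding distrib_right[symmetric] using theta_sum_le_one q by (intro mult_right_mono)
  then have ad: "?t1 * q + ?t2 * q < 1"
    using q by simp
  have inv: "invertible_mat (1\<^sub>m m + nystrom_block ?t1 m xG m xG wG K)"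
    using row nodes nn ad by (intro invertible_one_plus_nystrom_block[of "?t1 * q"]) auto
  have "\<exists>f. is_averaged_interpolant \<mu> D m xG wG xS wS K g f \<and>
      (\<forall>h. is_averaged_interpolant \<mu> D m xG wG xS wS K g h \<longrightarrow> (\<forall>y\<in>D. h y = f y))"
    by (rule averaged_interpolant_exists_unique[OF ad]) (fact row row' nodes nodes')+
  then obtain f where f: "is_averaged_interpolant \<mu> D m xG wG xS wS K g f"
    and unique: "\<forall>h. is_averaged_interpolant \<mu> D m xG wG xS wS K g h \<longrightarrow> (\<forall>y\<in>D. h y = f y)"
    by blast
  have f_eq: "f y + (\<Sum>j<m. ?t1 * wG j * K (xG j) y * f (xG j))
      + (\<Sum>j<Suc m. ?t2 * wS j * K (xS j) y * f (xS j)) = g y" if "y \<in> D" for y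
    using f that unfolding is_averaged_interpolant_def by (simp only: sum_distrib_left mult.assoc)
  note conv = block_iteration_converges[where D = D and K = K and f = f and g = g
      and m = m and n = "Suc m" and x = xG and w = wG and x' = xS and w' = wS
      and \<theta> = ?t1 and \<theta>' = ?t2, OF nn ad row row' nodes nodes' f_eq]
  show "let \<Phi>11 = nystrom_block (theta1 \<mu> D m) m xG m xG wG K;
         \<Phi>12 = nystrom_block (theta2 \<mu> D m) m xG (Suc m) xS wS K;
         \<Phi>21 = nystrom_block (theta1 \<mu> D m) (Suc m) xS m xG wG K;
         \<Phi>22 = nystrom_block (theta2 \<mu> D m) (Suc m) xS (Suc m) xS wS K;
         gG = vec m (\<lambda>i. g (xG i));
         gS = vec (Suc m) (\<lambda>i. g (xS i))
     in invertible_mat (1\<^sub>m m + \<Phi>11) \<and>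
        (\<exists>f. is_averaged_interpolant \<mu> D m xG wG xS wS K g f \<and>
          (\<forall>h. is_averaged_interpolant \<mu> D m xG wG xS wS K g h \<longrightarrow> (\<forall>y\<in>D. h y = f y)) \<and>
          (\<forall>c0 \<in> carrier_vec (Suc m). \<forall>b c.
             is_block_iteration m \<Phi>11 \<Phi>12 \<Phi>21 \<Phi>22 gG gS c0 b c \<longrightarrow>
             vec_tendsto m b (vec m (\<lambda>i. f (xG i))) \<and>
             vec_tendsto (Suc m) c (vec (Suc m) (\<lambda>i. f (xS i)))))"
    unfolding Let_def
    by (intro conjI inv exI[of _ f] f unique ballI allI impI conv)
qed

end
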